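(* Let $Z_n$ be the number of zeros of a random lattice path $P_n$ of length $n$ (chosen according to the model in the context). Let $r\ge1$ be an integer. For positive integers $n$ with $n\ge 2r-2$, \begin{align*} \mathbb{P}(Z_n=r)&=\frac{2^r}{n+1}\,\frac{\binom{\lceil n/2\rceil}{r}}{\binom nr}\left(\frac{2\lceil n/2\rceil}{r(r+1)}+\frac{r-1}{r+1}+[n\text{ even}]\,\frac1r\right)\\ &\quad+[n\text{ even}]\,\frac{2^{r-1}(r-1)}{(n+1)r}\,\frac{\binom{n/2}{r-1}}{\binom nr}. \end{align*} Moreover, $\mathbb{P}(Z_0=r)=[r=1]$ for all integers $r\ge 0$. In all other cases (that is, $n\ge1$ and either $n<2r-2$ or $r=0$), $\mathbb{P}(Z_n=r)=0$.
   Context: $[\mathit{expr}]$ is $1$ if $\mathit{expr}$ is true and $0$ otherwise; a term multiplied by a bracket equal to $0$ is taken to be $0$. Random path model: for an integer $n\ge0$, a random path $P_n$ on the lattice $\mathbb{Z}^2$ with steps $(1,+1)$ and $(1,-1)$, ending in $(n,0)$, is chosen as follows. First choose a starting point $(0,S)$ with $S$ uniformly distributed in $\{-n,-n+2,\dots,n-2,n\}$. Then choose a path uniformly at random among all paths from $(0,S)$ to $(n,0)$. A zero of $P_n$ is a lattice point $(x,0)\in P_n$ visited by the path (including the starting point if $S=0$ and the end point $(n,0)$). *)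

theory Defs
  imports "HOL-Probability.Probability"
begin

type_synonym lattice_point = "int \<times> int"

definition lattice_step :: "lattice_point \<Rightarrow> lattice_point \<Rightarrow> bool" where
  "lattice_step u v \<longleftrightarrow> v = (fst u + 1, snd u + 1) \<or> v = (fst u + 1, snd u - 1)"

text \<open>A path is the list of all the lattice points that it visits, both ends included.\<close>

definition lattice_paths :: "lattice_point \<Rightarrow> lattice_point \<Rightarrow> lattice_point list set" where
  "lattice_paths a b =
     {p. p \<noteq> [] \<and> hd p = a \<and> last p = b \<and> successively lattice_step p}"

definition start_heights :: "nat \<Rightarrow> int set" where
  "start_heights n = (\<lambda>k. 2 * int k - int n) ` {0..n}"

definition random_path :: "nat \<Rightarrow> lattice_point list pmf" where
  "random_path n =
     bind_pmf (pmf_of_set (start_heights n))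
       (\<lambda>S. pmf_of_set (lattice_paths (0, S) (int n, 0)))"

definition num_zeros :: "lattice_point list \<Rightarrow> nat" where
  "num_zeros p = card {q \<in> set p. snd q = 0}"

text \<open>
  The distribution \<open>pmf_of_set A\<close> is the uniform one only if \<open>A\<close> is finite and nonempty;
  the following facts show that this is the case for both choices in the model.
\<close>

lemma finite_start_heights: "finite (start_heights n)"
  and start_heights_nonempty: "start_heights n \<noteq> {}"
  by (auto simp: start_heights_def)

lemma path_fst_last:
  "p \<noteq> [] \<Longrightarrow> successively lattice_step p \<Longrightarrow>
   fst (last p) = fst (hd p) + int (length p) - 1"
proof (induction p rule: induct_list012)
  case (3 x y zs)
  then have "fst y = fst x + 1" by (auto simp: lattice_step_def)
  with 3 show ?case by simp
qed auto

lemma finite_paths_length: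
  "finite {p. p \<noteq> [] \<and> hd p = a \<and> length p = k \<and> successively lattice_step p}"
    (is "finite (?A a k)")
proof (induction k arbitrary: a)
  case 0
  then show ?case by simp
next
  case (Suc k)
  let ?u = "(fst a + 1, snd a + 1)" and ?d = "(fst a + 1, snd a - 1)"
  have "?A a (Suc k) \<subseteq> insert [a] ((#) a ` (?A ?u k \<union> ?A ?d k))"
  proof
    fix p assume p: "p \<in> ?A a (Suc k)"
    then obtain q where q: "p = a # q" by (cases p) auto
    show "p \<in> insert [a] ((#) a ` (?A ?u k \<union> ?A ?d k))"
      using p q by (cases q) (auto simp: lattice_step_def)
  qed
  moreover have "finite (insert [a] ((#) a ` (?A ?u k \<union> ?A ?d k)))"
    using Suc.IH[of ?u] Suc.IH[of ?d] by blast
  ultimately show ?case by (rule finite_subset)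
qed

lemma finite_lattice_paths: "finite (lattice_paths a b)"
proof (rule finite_subset)
  show "lattice_paths a b \<subseteq>
      {p. p \<noteq> [] \<and> hd p = a \<and> length p = nat (fst b - fst a + 1) \<and> successively lattice_step p}"
    using path_fst_last by (fastforce simp: lattice_paths_def)
qed (rule finite_paths_length)

lemma lattice_paths_Cons:
  assumes "q \<in> lattice_paths v b" "lattice_step a v"
  shows "a # q \<in> lattice_paths a b"
  using assms by (cases q) (auto simp: lattice_paths_def)

lemma lattice_paths_nonempty_aux:
  "k \<le> n \<Longrightarrow> lattice_paths (m - int n, 2 * int k - int n) (m, 0) \<noteq> {}"
proof (induction n arbitrary: k)
  case 0
  then have "[(m, 0)] \<in> lattice_paths (m - int 0, 2 * int k - int 0) (m, 0)"
    by (simp add: lattice_paths_def)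
  then show ?case by blast
next
  case (Suc n)
  show ?case
  proof (cases "k \<le> n")
    case True
    from Suc.IH[OF this] obtain q where
      "q \<in> lattice_paths (m - int n, 2 * int k - int n) (m, 0)" by blast
    then have "(m - int (Suc n), 2 * int k - int (Suc n)) # q
        \<in> lattice_paths (m - int (Suc n), 2 * int k - int (Suc n)) (m, 0)"
      by (rule lattice_paths_Cons) (simp add: lattice_step_def)
    then show ?thesis by blast
  next
    case False
    with Suc.prems have k: "k = Suc n" by simp
    from Suc.IH[of n] obtain q where
      "q \<in> lattice_paths (m - int n, 2 * int n - int n) (m, 0)" by blast
    then have "(m - int (Suc n), 2 * int k - int (Suc n)) # q
        \<in> lattice_paths (m - int (Suc n), 2 * int k - int (Suc n)) (m, 0)"
      by (rule lattice_paths_Cons) (simp add: lattice_step_def k)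
    then show ?thesis by blast
  qed
qed

lemma lattice_paths_nonempty:
  assumes "S \<in> start_heights n"
  shows "lattice_paths (0, S) (int n, 0) \<noteq> {}"
  using assms lattice_paths_nonempty_aux[of _ n "int n"] by (auto simp: start_heights_def)

end

theory Submission
  imports Defs
begin

text \<open>
  Let \<open>n = s + 2j\<close>. Conditioning on the first step shows that exactly
  \<open>2\<^sup>t b(s + t, j - t)\<close> paths of length \<open>n\<close> from height \<open>s\<close> or \<open>-s\<close> to \<open>0\<close> have \<open>t + 1\<close> zeros,
  where \<open>b(h, i) = h / (h + 2i) \<cdot> (h + 2i choose i)\<close> is the ballot number (\<open>b(0, 0) = 1\<close>). Divided by the number
  \<open>n choose j\<close> of all paths, this becomes a multiple, independent of \<open>j\<close>, of
  \<open>(n - 2j + t) (j choose t)\<close>, and the sum over \<open>j\<close> is evaluated by the hockey-stick identity.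
\<close>

section \<open>Absorption identity and ballot numbers\<close>

lemma Suc_times_choose_Suc:
  "real (Suc k) * real (n choose Suc k) = (real n - real k) * real (n choose k)"
  using gbinomial_mult_1[of "real n" k] by (simp add: binomial_gbinomial algebra_simps)

text \<open>This counts the paths with \<open>i\<close> up and \<open>h + i\<close> down steps from
  height \<open>h\<close> that reach 0 only at their end. The last equation splits by the first
  step.\<close>

fun ballot :: "nat \<Rightarrow> nat \<Rightarrow> nat" where
  "ballot 0 i = of_bool (i = 0)"
| "ballot (Suc h) 0 = 1"
| "ballot (Suc h) (Suc i) = ballot (Suc (Suc h)) i + ballot h (Suc i)"

lemma ballot_0_right [simp]: "ballot h 0 = 1"
  by (cases h) auto

text \<open>The multiplied form avoids the quotient 0/0 at \<open>h = i = 0\<close>. In the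
  induction both recursive terms belong to the same length \<open>?N\<close>.\<close>

lemma ballot_eq: "(h + 2 * i) * ballot h i = h * ((h + 2 * i) choose i)"
proof (induction h i rule: ballot.induct)
  case (3 h i)
  let ?N = "real h + 2 * real i + 2"
  have IH1: "?N * real (ballot (Suc (Suc h)) i) = (real h + 2) * real ((h + 2 * i + 2) choose i)"
    using arg_cong[OF "3.IH"(1), of real] by (simp add: algebra_simps)
  have IH2: "?N * real (ballot h (Suc i)) = real h * real ((h + 2 * i + 2) choose Suc i)"
    using arg_cong[OF "3.IH"(2), of real] by (simp add: algebra_simps)
  define A B C where "A = real ((h + 2 * i + 2) choose i)"
    and "B = real ((h + 2 * i + 2) choose Suc i)"
    and "C = real (ballot (Suc h) (Suc i))"
  have AB: "(real i + 1) * B = (real h + real i + 2) * A"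
    using Suc_times_choose_Suc[of i "h + 2 * i + 2"] by (simp add: A_def B_def algebra_simps)
  have NC: "?N * C = (real h + 2) * A + real h * B"
    using IH1 IH2 by (simp add: A_def B_def C_def algebra_simps)
  have "?N * ((?N + 1) * C) = (?N + 1) * (?N * C)"
    by simp
  \<comment> \<open>The second summand is twice the difference of the two sides of
    \<open>AB\<close>, so it vanishes, and \<open>?N > 0\<close> can be cancelled.\<close>
  also have "\<dots> = ?N * ((real h + 1) * (A + B)) +
      2 * ((real h + real i + 2) * A - (real i + 1) * B)"
    unfolding NC by (simp add: algebra_simps)
  also have "\<dots> = ?N * ((real h + 1) * (A + B))"
    using AB by simp
  finally have "(?N + 1) * C = (real h + 1) * (A + B)"
    by simp
  then have "real ((Suc h + 2 * Suc i) * ballot (Suc h) (Suc i)) =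
      real (Suc h * ((Suc h + 2 * Suc i) choose Suc i))"
    by (simp add: A_def B_def C_def algebra_simps del: ballot.simps)
  then show ?case
    by (simp only: of_nat_eq_iff)
qed auto

section \<open>Paths by number of zeros: recursion on the first step\<close>

definition zero_paths :: "int \<Rightarrow> nat \<Rightarrow> int \<Rightarrow> nat \<Rightarrow> lattice_point list set" where
  "zero_paths m n h r = {p \<in> lattice_paths (m - int n, h) (m, 0). num_zeros p = r}"

lemma lattice_paths_0: "lattice_paths (m, h) (m, 0) = (if h = 0 then {[(m, 0)]} else {})"
proof -
  have "p = [(m, h)] \<and> h = 0" if "p \<in> lattice_paths (m, h) (m, 0)" for p
  proof -
    from that have p: "p \<noteq> []" "hd p = (m, h)" "last p = (m, 0)" "successively lattice_step p"
      by (auto simp: lattice_paths_def)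
    from path_fst_last[OF p(1,4)] p have "length p = 1" by simp
    with p show ?thesis by (cases p) auto
  qed
  then show ?thesis by (auto simp: lattice_paths_def)
qed

text \<open>Removing the first point keeps the end \<open>(m, 0)\<close> and shortens the path by
  one; this is why starts are written as \<open>m - n\<close> with \<open>m\<close> free.\<close>

lemma lattice_paths_Suc:
  "lattice_paths (m - int (Suc n), h) (m, 0) =
     (#) (m - int (Suc n), h) `
       (lattice_paths (m - int n, h + 1) (m, 0) \<union> lattice_paths (m - int n, h - 1) (m, 0))"
    (is "?L = (#) ?a ` (?U \<union> ?D)")
proof
  show "?L \<subseteq> (#) ?a ` (?U \<union> ?D)"
  proof
    fix p assume p: "p \<in> ?L"
    then obtain q where q: "p = ?a # q" by (cases p) (auto simp: lattice_paths_def)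
    with p show "p \<in> (#) ?a ` (?U \<union> ?D)"
      by (cases q) (auto simp: lattice_paths_def lattice_step_def)
  qed
  show "(#) ?a ` (?U \<union> ?D) \<subseteq> ?L"
  proof -
    have "?a # q \<in> ?L" if "q \<in> ?U \<union> ?D" for q
      using that lattice_paths_Cons[of q "(m - int n, h + 1)" "(m, 0)" ?a]
        lattice_paths_Cons[of q "(m - int n, h - 1)" "(m, 0)" ?a]
      by (auto simp: lattice_step_def)
    then show ?thesis by blast
  qed
qed

lemma successively_fst_ge:
  "successively lattice_step p \<Longrightarrow> q \<in> set p \<Longrightarrow> fst (hd p) \<le> fst q"
  by (induction p rule: induct_list012) (auto simp: lattice_step_def)

text \<open>\<open>num_zeros\<close> is the size of a set of points. Abscissas never fall along a
  path, so the new leftmost point does not occur in \<open>q\<close> and is not counted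
  twice.\<close>

lemma num_zeros_Cons:
  assumes "q \<in> lattice_paths (x, h') b" "y < x"
  shows "num_zeros ((y, h) # q) = num_zeros q + of_bool (h = 0)"
proof -
  have "(y, h) \<notin> set q"
    using assms successively_fst_ge[of q "(y, h)"] by (auto simp: lattice_paths_def)
  moreover have "{v \<in> set ((y, h) # q). snd v = 0} =
      (if h = 0 then insert (y, h) {v \<in> set q. snd v = 0} else {v \<in> set q. snd v = 0})"
    by auto
  ultimately show ?thesis by (cases "h = 0") (simp_all add: num_zeros_def del: set_simps)
qed

lemma num_zeros_pos: "p \<in> lattice_paths a (m, 0) \<Longrightarrow> num_zeros p > 0"
proof -
  assume "p \<in> lattice_paths a (m, 0)"
  then have "(m, 0) \<in> {q \<in> set p. snd q = 0}"
    using last_in_set[of p] by (auto simp: lattice_paths_def)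
  moreover have "finite {q \<in> set p. snd q = 0}" by simp
  ultimately show ?thesis unfolding num_zeros_def card_gt_0_iff by blast
qed

lemma zero_paths_no_zeros: "zero_paths m n h 0 = {}"
  using num_zeros_pos by (fastforce simp: zero_paths_def)

lemma card_zero_paths_0: "card (zero_paths m 0 h r) = of_bool (h = 0 \<and> r = 1)"
proof -
  have "{q \<in> set [(m, 0 :: int)]. snd q = 0} = {(m, 0)}" by auto
  then have "num_zeros [(m, 0)] = 1" by (simp only: num_zeros_def card.insert) simp
  then have "{p \<in> {[(m, 0)]}. num_zeros p = r} = (if r = 1 then {[(m, 0)]} else {})" by auto
  then show ?thesis by (simp add: zero_paths_def lattice_paths_0)
qed

text \<open>The subtraction gives the number of zeros after the first step. \<open>R\<close> serves
  two uses: a singleton yields the recursion for \<open>zero_paths\<close>, and \<open>UNIV\<close>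
  yields Pascal's rule for all paths.\<close>

lemma card_lattice_paths_Suc:
  "card {p \<in> lattice_paths (m - int (Suc n), h) (m, 0). num_zeros p - of_bool (h = 0) \<in> R} =
   card {p \<in> lattice_paths (m - int n, h + 1) (m, 0). num_zeros p \<in> R} +
   card {p \<in> lattice_paths (m - int n, h - 1) (m, 0). num_zeros p \<in> R}"
    (is "card ?L = card ?U + card ?D")
proof -
  have "?L = (#) (m - int (Suc n), h) ` (?U \<union> ?D)"
    unfolding lattice_paths_Suc by (auto simp: num_zeros_Cons)
  moreover have "?U \<inter> ?D = {}" by (auto simp: lattice_paths_def)
  moreover have "finite ?U" "finite ?D" by (simp_all add: finite_lattice_paths)
  ultimately show ?thesis by (simp add: card_image card_Un_disjoint)
qed

lemma card_zero_paths_Suc: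
  "card (zero_paths m (Suc n) h (Suc t)) =
   (if h = 0 then card (zero_paths m n 1 t) + card (zero_paths m n (-1) t)
    else card (zero_paths m n (h + 1) (Suc t)) + card (zero_paths m n (h - 1) (Suc t)))"
proof (cases "h = 0")
  case True
  \<comment> \<open>Subtraction on naturals is truncated: for \<open>t = 0\<close> the sets agree
    because every path has at least one zero.\<close>
  have "zero_paths m (Suc n) h (Suc t) =
      {p \<in> lattice_paths (m - int (Suc n), h) (m, 0). num_zeros p - of_bool (h = 0) \<in> {t}}"
    using num_zeros_pos True by (fastforce simp: zero_paths_def)
  with True card_lattice_paths_Suc[of m n h "{t}"] show ?thesis
    by (simp add: zero_paths_def)
next
  case False
  with card_lattice_paths_Suc[of m n h "{Suc t}"] show ?thesis
    by (simp add: zero_paths_def)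
qed

section \<open>Closed forms for the path counts\<close>

lemma card_lattice_paths:
  "card (lattice_paths (m - int n, h) (m, 0)) =
   (if even (int n + h) \<and> \<bar>h\<bar> \<le> int n then n choose nat ((int n + h) div 2) else 0)"
proof (induction n arbitrary: h)
  case 0
  then show ?case by (auto simp: lattice_paths_0)
next
  case (Suc n)
  have rec: "card (lattice_paths (m - int (Suc n), h) (m, 0)) =
      card (lattice_paths (m - int n, h + 1) (m, 0)) + card (lattice_paths (m - int n, h - 1) (m, 0))"
    using card_lattice_paths_Suc[of m n h UNIV] by simp
  show ?case
  proof (cases "even (int (Suc n) + h) \<and> \<bar>h\<bar> \<le> int (Suc n)")
    case True
    \<comment> \<open>\<open>k\<close> is the number of down steps. For \<open>k = 0\<close> only
      the up step leads on; otherwise Pascal's rule applies.\<close>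
    define k where "k = nat ((int (Suc n) + h) div 2)"
    have h: "h = 2 * int k - int (Suc n)" "k \<le> Suc n" using True by (auto simp: k_def)
    show ?thesis
    proof (cases k)
      case 0
      then show ?thesis unfolding rec Suc.IH using h by simp
    next
      case (Suc l)
      then show ?thesis unfolding rec Suc.IH using h by (auto simp: binomial_eq_0 nat_add_distrib)
    qed
  next
    case False
    then show ?thesis unfolding rec Suc.IH by auto
  qed
qed

lemma card_zero_paths_outside: "\<bar>h\<bar> > int n \<Longrightarrow> card (zero_paths m n h r) = 0"
  using card_lattice_paths[of m n h] finite_lattice_paths[of "(m - int n, h)" "(m, 0)"]
  by (auto simp: zero_paths_def)

text \<open>From height 0 the two symmetric first steps supply a factor 2; elsewhere the first step
  reproduces the recursion of \<open>ballot\<close>. The bound \<open>t \<le> j\<close> reflects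
  that \<open>t + 1\<close> zeros enclose \<open>t\<close> excursions of at least two steps
  each.\<close>

lemma card_zero_paths:
  "\<bar>h\<bar> = int s \<Longrightarrow> n = s + 2 * j \<Longrightarrow>
   card (zero_paths m n h (Suc t)) = (if t \<le> j then 2 ^ t * ballot (s + t) (j - t) else 0)"
proof (induction n arbitrary: h s j t)
  case 0
  then show ?case by (auto simp: card_zero_paths_0)
next
  case (Suc n)
  show ?case
  proof (cases "s = 0")
    case True
    with Suc.prems obtain i where j: "j = Suc i" "n = Suc (2 * i)" "h = 0" by (cases j) auto
    \<comment> \<open>For \<open>t = 0\<close> both sides are 0: start and end are distinct zeros,
      and \<open>ballot 0 (Suc i) = 0\<close>.\<close>
    show ?thesis
    proof (cases t)
      case 0
      then show ?thesis using j True by (simp add: card_zero_paths_Suc zero_paths_no_zeros)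
    next
      case (Suc u)
      then show ?thesis
        using Suc.IH[of 1 1 i u] Suc.IH[of "-1" 1 i u] j True by (simp add: card_zero_paths_Suc)
    qed
  next
    case False
    then obtain s' where s: "s = Suc s'" by (cases s) auto
    define C where "C = (\<lambda>x. card (zero_paths m n x (Suc t)))"
    \<comment> \<open>\<open>down\<close> and \<open>up\<close> refer to the distance from the axis,
      which treats both signs of \<open>h\<close> alike.\<close>
    have down: "C x = (if t \<le> j then 2 ^ t * ballot (s' + t) (j - t) else 0)" if "\<bar>x\<bar> = int s'" for x
      unfolding C_def using Suc.IH[OF that, of j t] Suc.prems s by simp
    have up: "C x = (if Suc t \<le> j then 2 ^ t * ballot (s + 1 + t) (j - Suc t) else 0)"
      if "\<bar>x\<bar> = int (Suc s)" for x
    \<comment> \<open>For \<open>j = 0\<close> the remaining steps do not suffice to return after a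
      step away from the axis.\<close>
    proof (cases j)
      case 0
      then show ?thesis using Suc.prems that s by (simp add: C_def card_zero_paths_outside)
    next
      case (Suc i)
      then show ?thesis
        unfolding C_def using Suc.IH[OF that, of i t] Suc.prems s by simp
    qed
    have "card (zero_paths m (Suc n) h (Suc t)) = C (h + 1) + C (h - 1)"
      using Suc.prems s by (auto simp: card_zero_paths_Suc C_def)
    also have "\<dots> = (if Suc t \<le> j then 2 ^ t * ballot (s + 1 + t) (j - Suc t) else 0) +
        (if t \<le> j then 2 ^ t * ballot (s' + t) (j - t) else 0)"
    proof (cases "h > 0")
      case True
      then show ?thesis using up[of "h + 1"] down[of "h - 1"] Suc.prems s by simp
    next
      case False
      then show ?thesis using up[of "h - 1"] down[of "h + 1"] Suc.prems s by simp
    qed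
    also have "\<dots> = (if t \<le> j then 2 ^ t * ballot (s + t) (j - t) else 0)"
    proof (cases "j - t")
      case (Suc d)
      then have "j - Suc t = d" "Suc t \<le> j" by auto
      then show ?thesis using Suc s by (simp add: algebra_simps)
    qed auto
    finally show ?thesis .
  qed
qed

text \<open>After \<open>ballot_eq\<close>, the identity \<open>M\<close> cancels
  \<open>n choose j\<close>, and absorption rewrites the denominator. Only a linear factor and
  \<open>j choose t\<close> still depend on \<open>j\<close>, so the sum over \<open>j\<close>
  becomes tractable.\<close>

lemma card_zero_paths_ratio:
  assumes "n > 0" "2 * j \<le> n" "\<bar>h\<bar> = int (n - 2 * j)"
  shows "real (card (zero_paths m n h (Suc t))) / real (n choose j) =
    2 ^ t * (real n + real t - 2 * real j) * real (j choose t) / (real (Suc t) * real (n choose Suc t))"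
proof (cases "t \<le> j")
  case True
  \<comment> \<open>Since \<open>t \<le> j \<le> n/2\<close> and \<open>n > 0\<close>; this makes
    the divisor \<open>n - t\<close> nonzero.\<close>
  have tn: "t < n" using True assms by linarith
  let ?B = "real (ballot (n - 2 * j + t) (j - t))"
  have card: "card (zero_paths m n h (Suc t)) = 2 ^ t * ballot (n - 2 * j + t) (j - t)"
    using card_zero_paths[of h "n - 2 * j" n j m t] assms True by simp
  have "n - 2 * j + t + 2 * (j - t) = n - t" using True assms by simp
  from ballot_eq[of "n - 2 * j + t" "j - t", unfolded this]
  have "(n - t) * ballot (n - 2 * j + t) (j - t) = (n - 2 * j + t) * ((n - t) choose (j - t))" .
  from arg_cong[OF this, of real] have B:
    "(real n - real t) * ?B = (real n + real t - 2 * real j) * real ((n - t) choose (j - t))"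
    using tn assms by (simp add: of_nat_diff)
  have M: "real (n choose j) * real (j choose t) = real (n choose t) * real ((n - t) choose (j - t))"
    using choose_mult[of t j n] True assms by (simp flip: of_nat_mult)
  have A: "real (Suc t) * real (n choose Suc t) = (real n - real t) * real (n choose t)"
    by (rule Suc_times_choose_Suc)
  have pos: "real (n choose j) > 0" "real (n choose t) > 0" "real n - real t > 0"
    using tn assms by simp_all
  have "?B * ((real n - real t) * real (n choose t)) =
      (real n + real t - 2 * real j) * real (j choose t) * real (n choose j)"
  proof -
    have "?B * ((real n - real t) * real (n choose t)) =
        ((real n - real t) * ?B) * real (n choose t)"
      by (simp only: mult_ac)
    also have "\<dots> = (real n + real t - 2 * real j) *
        (real (n choose t) * real ((n - t) choose (j - t)))"
      unfolding B by (simp only: mult_ac)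
    finally show ?thesis
      unfolding M[symmetric] by (simp only: mult_ac)
  qed
  moreover have "(real n - real t) * real (n choose t) \<noteq> 0" using pos by simp
  ultimately have "?B / real (n choose j) =
      (real n + real t - 2 * real j) * real (j choose t) / ((real n - real t) * real (n choose t))"
    using pos by (subst frac_eq_eq) simp_all
  then show ?thesis unfolding A card by (simp flip: times_divide_eq_right)
next
  case False
  then show ?thesis
    using card_zero_paths[of h "n - 2 * j" n j m t] assms by simp
qed

section \<open>Averaging over the starting height and summation\<close>

lemma prob_num_zeros:
  "measure_pmf.prob (random_path n) {p. num_zeros p = r} =
     (\<Sum>k\<le>n. real (card (zero_paths (int n) n (2 * int k - int n) r)) / real (n choose k)) / (real n + 1)"
proof -
  define Q where
    "Q k = real (card (zero_paths (int n) n (2 * int k - int n) r)) / real (n choose k)" for k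
  have inj: "inj_on (\<lambda>k. 2 * int k - int n) {0..n}" by (auto intro!: inj_onI)
  have card: "card (start_heights n) = n + 1"
    unfolding start_heights_def using inj by (simp add: card_image)
  have Q: "pmf (map_pmf num_zeros (pmf_of_set (lattice_paths (0, 2 * int k - int n) (int n, 0)))) r = Q k"
    if "k \<le> n" for k
  proof -
    have "lattice_paths (0, 2 * int k - int n) (int n, 0) \<noteq> {}"
      using that by (intro lattice_paths_nonempty) (auto simp: start_heights_def)
    moreover have "card (lattice_paths (0, 2 * int k - int n) (int n, 0)) = n choose k"
      using card_lattice_paths[of "int n" n "2 * int k - int n"] that by simp
    ultimately show ?thesis
      by (simp add: pmf_map measure_pmf_of_set finite_lattice_paths Q_def zero_paths_def
          Collect_conj_eq vimage_def)
  qed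
  \<comment> \<open>As a point mass of the image distribution, the event can be conditioned on
    \<open>S\<close> through \<open>pmf_bind\<close>.\<close>
  have "measure_pmf.prob (random_path n) {p. num_zeros p = r} =
      pmf (map_pmf num_zeros (random_path n)) r"
    by (simp add: pmf_map vimage_def)
  also have "\<dots> = (\<Sum>S\<in>start_heights n.
      pmf (map_pmf num_zeros (pmf_of_set (lattice_paths (0, S) (int n, 0)))) r) / (real n + 1)"
    by (simp add: random_path_def map_bind_pmf pmf_bind integral_pmf_of_set
        finite_start_heights start_heights_nonempty card add.commute)
  also have "\<dots> = (\<Sum>k\<le>n. Q k) / (real n + 1)"
    unfolding start_heights_def sum.reindex[OF inj] using Q by (simp add: atMost_atLeast0)
  finally show ?thesis by (simp add: Q_def)
qed

text \<open>Indices \<open>k\<close> and \<open>n - k\<close> belong to opposite starting heights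
  and contribute equally; the self-paired middle index exists only for even
  \<open>n\<close>.\<close>

lemma sum_min_reflect:
  fixes f :: "nat \<Rightarrow> real"
  shows "(\<Sum>k\<le>n. f (min k (n - k))) =
    2 * (\<Sum>j<(n + 1) div 2. f j) + of_bool (even n) * f (n div 2)"
proof -
  let ?m = "(n + 1) div 2"
  let ?g = "\<lambda>k. f (min k (n - k))"
  have "{..n} = {..<?m} \<union> {k. k \<le> n \<and> 2 * k = n} \<union> {k. k \<le> n \<and> n < 2 * k}" by auto
  then have "sum ?g {..n} = sum ?g ({..<?m} \<union> {k. k \<le> n \<and> 2 * k = n} \<union> {k. k \<le> n \<and> n < 2 * k})"
    by simp
  also have "\<dots> = sum ?g {..<?m} + sum ?g {k. k \<le> n \<and> 2 * k = n} + sum ?g {k. k \<le> n \<and> n < 2 * k}"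
    by (subst sum.union_disjoint; (subst sum.union_disjoint)?) auto
  also have "sum ?g {..<?m} = (\<Sum>j<?m. f j)"
    by (rule sum.cong) (auto simp: min_def)
  also have "sum ?g {k. k \<le> n \<and> n < 2 * k} = (\<Sum>j<?m. f j)"
    by (rule sum.reindex_bij_witness[of _ "\<lambda>j. n - j" "\<lambda>k. n - k"]) (auto simp: min_def)
  also have "{k. k \<le> n \<and> 2 * k = n} = (if even n then {n div 2} else {})" by auto
  then have "sum ?g {k. k \<le> n \<and> 2 * k = n} = of_bool (even n) * f (n div 2)"
    by (auto simp: min_def elim!: evenE)
  finally show ?thesis by simp
qed

text \<open>The closed form comes from \<open>2j = 2(j + 1) - 2\<close> and
  \<open>(j + 1) (j choose t) = (t + 1) (j + 1 choose t + 1)\<close>, with the hockey-stick identity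
  applied to both parts.\<close>

lemma sum_linear_times_binomial:
  fixes a :: real
  shows "(\<Sum>j<m. (a - 2 * real j) * real (j choose t)) =
    (a + 2 - 2 * real (Suc t) * (real m + 1) / (real t + 2)) * real (m choose Suc t)"
proof (induction m)
  case (Suc m)
  have A: "real (Suc t) * real (m choose Suc t) = (real m - real t) * real (m choose t)"
    by (rule Suc_times_choose_Suc)
  show ?case unfolding sum.lessThan_Suc Suc.IH binomial_Suc_Suc
    using A by (simp add: field_simps)
qed simp

lemma prob_num_zeros_Suc:
  assumes "n > 0"
  shows "measure_pmf.prob (random_path n) {p. num_zeros p = Suc t} =
    2 ^ t / ((real n + 1) * (real (Suc t) * real (n choose Suc t))) *
    (2 * (\<Sum>j<(n + 1) div 2. (real n + real t - 2 * real j) * real (j choose t)) +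
      of_bool (even n) * (real t * real ((n div 2) choose t)))"
proof -
  define D where "D = real (Suc t) * real (n choose Suc t)"
  define f where "f j = (real n + real t - 2 * real j) * real (j choose t)" for j
  have "real (card (zero_paths (int n) n (2 * int k - int n) (Suc t))) / real (n choose k) =
      2 ^ t / D * f (min k (n - k))" if "k \<le> n" for k
  proof -
    \<comment> \<open>The smaller of the numbers of down and up steps, so the distance of the start
      from the axis is \<open>n - 2 * j\<close>.\<close>
    define j where "j = min k (n - k)"
    have "n choose k = n choose j"
      using binomial_symmetric[OF that] by (simp add: j_def min_def)
    moreover have "\<bar>2 * int k - int n\<bar> = int (n - 2 * j)" "2 * j \<le> n"
      using that by (auto simp: j_def min_def)
    ultimately show ?thesis
      using card_zero_paths_ratio[OF assms, of j "2 * int k - int n" "int n" t]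
      by (simp add: f_def D_def mult.assoc flip: j_def)
  qed
  then have "(\<Sum>k\<le>n. real (card (zero_paths (int n) n (2 * int k - int n) (Suc t))) / real (n choose k)) =
      2 ^ t / D * (\<Sum>k\<le>n. f (min k (n - k)))"
    by (simp add: sum_distrib_left)
  \<comment> \<open>At \<open>j = n/2\<close> the linear factor reduces to \<open>t\<close>.\<close>
  moreover have "of_bool (even n) * f (n div 2) = of_bool (even n) * (real t * real ((n div 2) choose t))"
    by (auto simp: f_def elim!: evenE)
  ultimately show ?thesis
    unfolding prob_num_zeros sum_min_reflect by (simp add: f_def D_def mult_ac)
qed

lemma prob_num_zeros_0: "measure_pmf.prob (random_path n) {p. num_zeros p = 0} = 0"
  by (simp add: prob_num_zeros zero_paths_no_zeros)

section \<open>Bringing the sums into the stated form\<close>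

theorem theoremE1:
  shows "(\<forall>r n :: nat. r \<ge> 1 \<and> n > 0 \<and> n \<ge> 2 * r - 2 \<longrightarrow>
            measure_pmf.prob (random_path n) {p. num_zeros p = r} =
              2 ^ r / (real n + 1)
                * (real (nat \<lceil>real n / 2\<rceil> choose r) / real (n choose r))
                * (2 * real_of_int \<lceil>real n / 2\<rceil> / (real r * (real r + 1))
                   + (real r - 1) / (real r + 1)
                   + of_bool (even n) * (1 / real r))
              + of_bool (even n)
                * (2 ^ (r - 1) * (real r - 1) / ((real n + 1) * real r))
                * (real ((n div 2) choose (r - 1)) / real (n choose r)))
       \<and> (\<forall>r :: nat. measure_pmf.prob (random_path 0) {p. num_zeros p = r} = of_bool (r = 1))
       \<and> (\<forall>r n :: nat. n \<ge> 1 \<and> (n < 2 * r - 2 \<or> r = 0) \<longrightarrow>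
            measure_pmf.prob (random_path n) {p. num_zeros p = r} = 0)"
proof (intro conjI allI impI)
  fix r n :: nat
  assume "r \<ge> 1 \<and> n > 0 \<and> n \<ge> 2 * r - 2"
  then obtain t where r: "r = Suc t" and n: "n > 0" by (cases r) auto
  define m where "m = (n + 1) div 2"
  define X where "X = real (m choose Suc t)"
  define Y where "Y = real ((n div 2) choose t)"
  define e :: real where "e = of_bool (even n)"
  define D where "D = real (n choose Suc t)"
  \<comment> \<open>The bracket of the claimed formula at \<open>r = t + 1\<close>.\<close>
  define b where "b = 2 * real m / ((real t + 1) * (real t + 2)) + real t / (real t + 2) + e / (real t + 1)"
  have m: "\<lceil>real n / 2\<rceil> = int m"
    unfolding m_def by linarith
  \<comment> \<open>This covers both parities at once and turns the hockey-stick coefficient with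
    \<open>a = n + t\<close> into \<open>(t + 1) * b\<close>.\<close>
  have "real n = 2 * real m - 1 + e"
    unfolding m_def e_def by (cases "even n") (auto elim!: evenE oddE)
  then have b: "real n + real t + 2 - 2 * real (Suc t) * (real m + 1) / (real t + 2) = (real t + 1) * b"
    by (simp add: b_def divide_simps) (simp add: algebra_simps)
  have "measure_pmf.prob (random_path n) {p. num_zeros p = r} =
      2 ^ t / ((real n + 1) * ((real t + 1) * D)) * (2 * ((real t + 1) * b * X) + e * (real t * Y))"
    unfolding r prob_num_zeros_Suc[OF n] m_def[symmetric] sum_linear_times_binomial b
    by (simp add: X_def Y_def D_def e_def add.commute)
  also have "\<dots> = 2 ^ Suc t / (real n + 1) * (X / D) * b
      + e * (2 ^ t * real t / ((real n + 1) * (real t + 1))) * (Y / D)"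
  proof -
    \<comment> \<open>If \<open>p\<close> or \<open>D\<close> is 0, both sides are 0 because
      division by 0 yields 0.\<close>
    have "2 ^ t / (p * (q * D)) * (2 * (q * b * X) + e * (real t * Y)) =
        2 ^ Suc t / p * (X / D) * b + e * (2 ^ t * real t / (p * q)) * (Y / D)"
      if "q \<noteq> 0" for p q
      using that by (cases "p = 0 \<or> D = 0") (auto simp: field_simps)
    from this[of "real t + 1" "real n + 1"] show ?thesis by simp
  qed
  finally show "measure_pmf.prob (random_path n) {p. num_zeros p = r} =
      2 ^ r / (real n + 1)
        * (real (nat \<lceil>real n / 2\<rceil> choose r) / real (n choose r))
        * (2 * real_of_int \<lceil>real n / 2\<rceil> / (real r * (real r + 1))
           + (real r - 1) / (real r + 1)
           + of_bool (even n) * (1 / real r))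
      + of_bool (even n)
        * (2 ^ (r - 1) * (real r - 1) / ((real n + 1) * real r))
        * (real ((n div 2) choose (r - 1)) / real (n choose r))"
    unfolding m r by (simp add: X_def Y_def D_def e_def b_def add.commute)
next
  fix r :: nat
  show "measure_pmf.prob (random_path 0) {p. num_zeros p = r} = of_bool (r = 1)"
    by (simp add: prob_num_zeros card_zero_paths_0)
next
  fix r n :: nat
  assume "n \<ge> 1 \<and> (n < 2 * r - 2 \<or> r = 0)"
  then show "measure_pmf.prob (random_path n) {p. num_zeros p = r} = 0"
  proof (cases r)
    case (Suc t)
    then have "n > 0" "n < 2 * t" using \<open>n \<ge> 1 \<and> _\<close> by auto
    \<comment> \<open>All summation indices and \<open>n div 2\<close> lie below \<open>t\<close>,
      so every binomial coefficient with lower index \<open>t\<close> vanishes.\<close>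
    then show ?thesis
      by (auto simp: Suc prob_num_zeros_Suc binomial_eq_0 intro!: sum.neutral)
  qed (simp add: prob_num_zeros_0)
qed

end
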